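(* Consider the system of $N$ agents $\dot x_i = A x_i + B u_i$, $y_i = C x_i$, $i=1,\dots,N$, where $B$ and $C$ have full rank and $(A,B,C)$ is output controllable; let $a_1,\dots,a_N>0$ and $t_0<T<\infty$. The controllers $$u(x,t) = -\Big(L(a)\otimes \big(B^Te^{A^T(T-t)}C^TW(t,T)^{-1}Ce^{A(T-t)}\big)\Big)x$$ and, when $\ker(C)$ is $A$-invariant, $$u(y,t) = -\Big(L(a)\otimes \big(B^TC^TG(t,T)^{-1}\big)\Big)y$$ use only relative information: for each $t\in[t_0,T)$ and each $i$, the control $u_i$ of agent $i$ is a function of only the differences of the states $x_1-x_i,\dots,x_N-x_i$ (for the first controller), respectively of only the differences of the outputs $y_1-y_i,\dots,y_N-y_i$ (for the second controller).
   Context: Here $x_i(t)\in\mathbb{R}^n$, $u_i(t)\in\mathbb{R}^m$, $y_i(t)\in\mathbb{R}^p$, $A\in\mathbb{R}^{n\times n}$, $B\in\mathbb{R}^{n\times m}$, $C\in\mathbb{R}^{p\times n}$; $x,u,y$ are the stacked vectors $[x_1^T,\dots,x_N^T]^T$, $[u_1^T,\dots,u_N^T]^T$, $[y_1^T,\dots,y_N^T]^T$; $a=[a_1,\dots,a_N]^T$. $L(a) = I_N - \big(\sum_{i=1}^N a_i\big)^{-1}1_N a^T$, where $1_N\in\mathbb{R}^N$ is the all-ones vector; $\otimes$ is the Kronecker product. $W(t,T)=\int_t^T Ce^{A(T-s)}BB^Te^{A^T(T-s)}C^T\,ds$, and output controllability means that $W(t,T)$ is nonsingular for $t<T$. $G(t,T)=\int_0^{T-t}Ce^{-Ar}BB^Te^{-A^Tr}C^T\,dr$.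 A superscript $T$ on a matrix or vector denotes transpose; otherwise $T$ is the terminal time. *)

theory Defs
  imports "HOL-Analysis.Analysis"
begin

text \<open>
  An element of \<^typ>\<open>real^'m^'n\<close> is a matrix with rows indexed by \<open>'n\<close> and columns indexed
  by \<open>'m\<close>. The product class operation on \<^typ>\<open>real^'n^'n\<close> is entrywise, so neither
  \<open>(^)\<close> nor \<^const>\<open>exp\<close> gives the matrix notion.
\<close>

primrec mat_power :: "real^'n^'n \<Rightarrow> nat \<Rightarrow> real^'n^'n" where
  "mat_power A 0 = mat 1"
| "mat_power A (Suc k) = A ** mat_power A k"

definition mat_exp :: "real^'n^'n \<Rightarrow> real^'n^'n" where
  "mat_exp A = (\<Sum>k. (1 / fact k) *\<^sub>R mat_power A k)"

definition full_rank :: "real^'m^'n \<Rightarrow> bool" where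
  "full_rank M \<longleftrightarrow> rank M = min CARD('n) CARD('m)"

text \<open>
  The vector that stacks one vector of \<^typ>\<open>real^'n\<close> for each agent is indexed by pairs
  (agent, coordinate).
\<close>

definition agent :: "real^('N::finite \<times> 'n::finite) \<Rightarrow> 'N \<Rightarrow> real^'n" where
  "agent x i = (\<chi> k. x $ (i, k))"

definition kronecker ::
    "real^'b^'a \<Rightarrow> real^'d^'c \<Rightarrow> real^('b \<times> 'd)^('a \<times> 'c)"  (infixr "\<otimes>\<^sub>K" 75) where
  "P \<otimes>\<^sub>K Q = (\<chi> r s. P $ fst r $ fst s * Q $ snd r $ snd s)"

definition weighted_laplacian :: "real^'N \<Rightarrow> real^'N^'N" where
  "weighted_laplacian a =
     mat 1 - inverse (\<Sum>i\<in>UNIV. a $ i) *\<^sub>R ((columnvector 1 :: real^1^'N) ** rowvector a)"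

definition W_gramian ::
    "real^'n^'n \<Rightarrow> real^'m^'n \<Rightarrow> real^'n^'p \<Rightarrow> real \<Rightarrow> real \<Rightarrow> real^'p^'p" where
  "W_gramian A B C t T =
     integral {t..T} (\<lambda>s. C ** mat_exp ((T - s) *\<^sub>R A) ** B ** transpose B
                            ** mat_exp ((T - s) *\<^sub>R transpose A) ** transpose C)"

definition G_gramian ::
    "real^'n^'n \<Rightarrow> real^'m^'n \<Rightarrow> real^'n^'p \<Rightarrow> real \<Rightarrow> real \<Rightarrow> real^'p^'p" where
  "G_gramian A B C t T =
     integral {0..T - t} (\<lambda>r. C ** mat_exp ((- r) *\<^sub>R A) ** B ** transpose B
                                ** mat_exp ((- r) *\<^sub>R transpose A) ** transpose C)"

definition output_controllable :: "real^'n^'n \<Rightarrow> real^'m^'n \<Rightarrow> real^'n^'p \<Rightarrow> bool" where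
  "output_controllable A B C \<longleftrightarrow> (\<forall>t T. t < T \<longrightarrow> invertible (W_gramian A B C t T))"

definition kernel_invariant :: "real^'n^'n \<Rightarrow> real^'n^'p \<Rightarrow> bool" where
  "kernel_invariant A C \<longleftrightarrow> (*v) A ` {x. C *v x = 0} \<subseteq> {x. C *v x = 0}"

definition state_controller ::
    "real^'n^'n \<Rightarrow> real^'m^'n \<Rightarrow> real^'n^'p \<Rightarrow> real^'N \<Rightarrow> real
       \<Rightarrow> real^('N \<times> 'n) \<Rightarrow> real \<Rightarrow> real^('N \<times> 'm)" where
  "state_controller A B C a T x t =
     - ((weighted_laplacian a \<otimes>\<^sub>K
          (transpose B ** mat_exp ((T - t) *\<^sub>R transpose A) ** transpose C
             ** matrix_inv (W_gramian A B C t T) ** C ** mat_exp ((T - t) *\<^sub>R A))) *v x)"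

definition output_controller ::
    "real^'n^'n \<Rightarrow> real^'m^'n \<Rightarrow> real^'n^'p \<Rightarrow> real^'N \<Rightarrow> real
       \<Rightarrow> real^('N \<times> 'p) \<Rightarrow> real \<Rightarrow> real^('N \<times> 'm)" where
  "output_controller A B C a T y t =
     - ((weighted_laplacian a \<otimes>\<^sub>K
          (transpose B ** transpose C ** matrix_inv (G_gramian A B C t T))) *v y)"

end

theory Submission
  imports Defs
begin

text \<open>
  Both controllers have the form \<open>u = - (L(a) \<otimes>\<^sub>K K) *v z\<close>, where \<open>z\<close> stacks the states or
  the outputs and \<open>K\<close> is a gain that is the same for all agents. The block of agent \<open>i\<close> is then
  \<open>- (\<Sum>j. L(a)\<^sub>i\<^sub>j *\<^sub>R (K *v z\<^sub>j))\<close>. Every row of \<open>L(a)\<close> sums to zero, since the weights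
  \<open>a\<^sub>j / (\<Sum>k. a\<^sub>k)\<close> that are subtracted from the identity sum to one. A linear combination whose
  coefficients sum to zero does not change under a common translation of its arguments, so each
  \<open>z\<^sub>j\<close> may be replaced by \<open>z\<^sub>j - z\<^sub>i\<close>, and the control becomes an explicit function of the
  differences. The positivity of the weights makes their sum nonzero, so that the normalization in
  \<open>L(a)\<close> is meaningful.
\<close>

lemma agent_uminus: "agent (- x) i = - agent x i"
  by (simp add: agent_def vec_eq_iff)

lemma agent_kronecker_mult:
  fixes P :: "real^'N^'M" and Q :: "real^'n^'m"
  shows "agent ((P \<otimes>\<^sub>K Q) *v x) i = (\<Sum>j\<in>UNIV. P $ i $ j *\<^sub>R (Q *v agent x j))"
  by (simp add: vec_eq_iff agent_def kronecker_def matrix_vector_mult_def sum_distrib_left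
      sum.cartesian_product mult.assoc case_prod_unfold flip: UNIV_Times_UNIV)

lemma weighted_laplacian_row_sum:
  assumes "(\<Sum>k\<in>UNIV. a $ k) \<noteq> 0"
  shows "(\<Sum>j\<in>UNIV. weighted_laplacian a $ i $ j) = 0"
proof -
  have "weighted_laplacian a $ i $ j =
      (if i = j then 1 else 0) - inverse (\<Sum>k\<in>UNIV. a $ k) * a $ j" for j
    by (simp add: weighted_laplacian_def mat_def matrix_matrix_mult_def
        columnvector_def rowvector_def)
  then show ?thesis
    using assms by (simp add: sum_subtractf flip: sum_distrib_left)
qed

text \<open>
  With row sum zero, subtracting the reference vector of agent \<open>i\<close> from the vectors of all agents
  changes the combination by the row sum times the image of that reference vector, that is, by zero.
\<close>

lemma agent_kronecker_mult_differences:
  fixes P :: "real^'N^'N" and Q :: "real^'n^'m"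
  assumes "(\<Sum>j\<in>UNIV. P $ i $ j) = 0"
  shows "agent ((P \<otimes>\<^sub>K Q) *v x) i =
    (\<Sum>j\<in>UNIV. P $ i $ j *\<^sub>R (Q *v (agent x j - agent x i)))"
proof -
  have "(\<Sum>j\<in>UNIV. P $ i $ j *\<^sub>R (Q *v (agent x j - agent x i))) =
      (\<Sum>j\<in>UNIV. P $ i $ j *\<^sub>R (Q *v agent x j)) - (\<Sum>j\<in>UNIV. P $ i $ j) *\<^sub>R (Q *v agent x i)"
    by (simp add: matrix_vector_mult_diff_distrib scaleR_diff_right sum_subtractf scaleR_sum_left)
  then show ?thesis
    using assms by (simp add: agent_kronecker_mult)
qed

lemma laplacian_feedback_uses_differences:
  fixes a :: "real^'N" and K :: "real^'n^'m"
  assumes "(\<Sum>k\<in>UNIV. a $ k) \<noteq> 0"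
  shows "\<exists>\<phi> :: ('N \<Rightarrow> real^'n) \<Rightarrow> real^'m. \<forall>x.
    agent (- ((weighted_laplacian a \<otimes>\<^sub>K K) *v x)) i = \<phi> (\<lambda>j. agent x j - agent x i)"
proof (intro exI allI)
  fix x :: "real^('N \<times> 'n)"
  show "agent (- ((weighted_laplacian a \<otimes>\<^sub>K K) *v x)) i =
      (\<lambda>d. - (\<Sum>j\<in>UNIV. weighted_laplacian a $ i $ j *\<^sub>R (K *v d j)))
        (\<lambda>j. agent x j - agent x i)"
    by (simp add: agent_uminus
        agent_kronecker_mult_differences[OF weighted_laplacian_row_sum[OF assms]])
qed

theorem corollary1:
  fixes A :: "real^'n^'n" and B :: "real^'m^'n" and C :: "real^'n^'p"
    and a :: "real^'N" and t0 T :: real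
  assumes "full_rank B" and "full_rank C"
    and "output_controllable A B C"
    and "\<forall>i. a $ i > 0"
    and "t0 < T"
  shows "(\<forall>t\<in>{t0..<T}. \<forall>i::'N. \<exists>\<phi> :: ('N \<Rightarrow> real^'n) \<Rightarrow> real^'m.
            \<forall>x :: real^('N \<times> 'n).
              agent (state_controller A B C a T x t) i = \<phi> (\<lambda>j. agent x j - agent x i))
       \<and> (kernel_invariant A C \<longrightarrow>
           (\<forall>t\<in>{t0..<T}. \<forall>i::'N. \<exists>\<psi> :: ('N \<Rightarrow> real^'p) \<Rightarrow> real^'m.
              \<forall>y :: real^('N \<times> 'p).
                agent (output_controller A B C a T y t) i = \<psi> (\<lambda>j. agent y j - agent y i)))"
proof -
  have "(\<Sum>k\<in>UNIV. a $ k) > 0"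
    using assms(4) by (intro sum_pos) auto
  then have "(\<Sum>k\<in>UNIV. a $ k) \<noteq> 0"
    by simp
  note differences = laplacian_feedback_uses_differences[OF this]
  show ?thesis
    unfolding state_controller_def output_controller_def
    by (intro conjI impI ballI allI differences)
qed

end
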